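(* Let $\{\gamma_k\}_{k=0}^{\infty}$ be a multiplier sequence for the Legendre basis, and suppose there is a polynomial $p\in\mathbb{R}[x]$ with $\gamma_k=p(k)$ for all $k=0,1,2,\dots$. Then there exists a polynomial $h\in\mathbb{R}[x]$ such that $p(x)=h(x^2+x)$.
   Context: For each nonnegative integer $k$, $P_k$ denotes the $k$-th Legendre polynomial: the polynomial solution of $(x^2-1)y''+2xy'-k(k+1)y=0$ normalized by $P_k(1)=1$. A polynomial in $\mathbb{R}[x]$ is called hyperbolic if all of its zeros are real; by convention the zero polynomial is hyperbolic (and so are nonzero constants). An operator on $\mathbb{R}[x]$ is a hyperbolicity preserver if it maps every hyperbolic polynomial to a hyperbolic polynomial. A real sequence $\{\gamma_k\}_{k=0}^{\infty}$ is a multiplier sequence for the Legendre basis if the linear operator $T$ on $\mathbb{R}[x]$ defined by $T[P_k]=\gamma_kP_k$ for all $k\ge 0$ is a hyperbolicity preserver. *)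

theory Defs
  imports Complex_Main "HOL-Computational_Algebra.Polynomial"
begin

definition hyperbolic :: "real poly \<Rightarrow> bool" where
  "hyperbolic p \<longleftrightarrow> p = 0 \<or> (\<forall>z::complex. poly (map_poly complex_of_real p) z = 0 \<longrightarrow> z \<in> \<real>)"

definition hyperbolicity_preserver :: "(real poly \<Rightarrow> real poly) \<Rightarrow> bool" where
  "hyperbolicity_preserver T \<longleftrightarrow> (\<forall>p. hyperbolic p \<longrightarrow> hyperbolic (T p))"

definition is_legendre :: "nat \<Rightarrow> real poly \<Rightarrow> bool" where
  "is_legendre k y \<longleftrightarrow>
     [:-1, 0, 1:] * pderiv (pderiv y) + [:0, 2:] * pderiv y - smult (real k * (real k + 1)) y = 0
     \<and> poly y 1 = 1"

text \<open>The description is justified by \<open>ex1_is_legendre\<close>.\<close>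
definition legendre :: "nat \<Rightarrow> real poly" where
  "legendre k = (THE y. is_legendre k y)"

text \<open>The operator \<open>T\<close> exists and is unique for every \<open>\<gamma>\<close>, see \<open>ex1_legendre_operator\<close>;
  so the existential quantifier only names it.\<close>
definition legendre_multiplier_sequence :: "(nat \<Rightarrow> real) \<Rightarrow> bool" where
  "legendre_multiplier_sequence \<gamma> \<longleftrightarrow>
     (\<exists>T. Vector_Spaces.linear smult smult T
        \<and> (\<forall>k. T (legendre k) = smult (\<gamma> k) (legendre k))
        \<and> hyperbolicity_preserver T)"

text \<open>In powers of \<open>x - 1\<close>, the differential equation is a two-term recurrence for the
  coefficients.\<close>
lemma legendre_ode_iff:
  fixes y :: "real poly"
  defines "e \<equiv> y \<circ>\<^sub>p [:1, 1:]"
  shows "[:-1, 0, 1:] * pderiv (pderiv y) + [:0, 2:] * pderiv y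
           - smult (real k * (real k + 1)) y = 0 \<longleftrightarrow>
    (\<forall>j. 2 * (real j + 1)^2 * coeff e (Suc j)
         = (real k * (real k + 1) - real j * (real j + 1)) * coeff e j)"
    (is "?L = 0 \<longleftrightarrow> _")
proof -
  have d1: "pderiv e = pderiv y \<circ>\<^sub>p [:1, 1:]"
    by (simp add: e_def pderiv_pcompose pderiv_pCons)
  have d2: "pderiv (pderiv e) = pderiv (pderiv y) \<circ>\<^sub>p [:1, 1:]"
    by (simp add: d1 pderiv_pcompose pderiv_pCons)
  have "?L = 0 \<longleftrightarrow> ?L \<circ>\<^sub>p [:1, 1:] = 0"
    by (subst pcompose_eq_0_iff) auto
  also have "?L \<circ>\<^sub>p [:1, 1:] = [:0, 2, 1:] * pderiv (pderiv e) + [:2, 2:] * pderiv e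
       - smult (real k * (real k + 1)) e"
  proof -
    have "[:-1, 0, 1:] \<circ>\<^sub>p [:1, 1:] = [:0, 2, 1 :: real:]"
      "[:0, 2:] \<circ>\<^sub>p [:1, 1:] = [:2, 2 :: real:]"
      by (simp_all add: pcompose_pCons)
    then show ?thesis
      unfolding d2 unfolding d1 unfolding e_def
      by (simp only: pcompose_add pcompose_diff pcompose_mult pcompose_smult)
  qed
  also have "\<dots> = 0 \<longleftrightarrow> (\<forall>j. 2 * (real j + 1)^2 * coeff e (Suc j)
         = (real k * (real k + 1) - real j * (real j + 1)) * coeff e j)"
    unfolding poly_eq_iff
  proof (intro all_cong1)
    fix j
    show "coeff ([:0, 2, 1:] * pderiv (pderiv e) + [:2, 2:] * pderiv e
        - smult (real k * (real k + 1)) e) j = coeff 0 j \<longleftrightarrow>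
      2 * (real j + 1)^2 * coeff e (Suc j)
         = (real k * (real k + 1) - real j * (real j + 1)) * coeff e j"
    proof (cases j)
      case 0
      then show ?thesis by (simp add: coeff_pderiv)
    next
      case (Suc i)
      then show ?thesis
        by (cases i) (auto simp: coeff_pderiv power2_eq_square algebra_simps)
    qed
  qed
  finally show ?thesis .
qed

lemma poly_1_eq_coeff: "poly y (1::real) = coeff (y \<circ>\<^sub>p [:1, 1:]) 0"
  by (simp add: pcompose_coeff_0)

lemma shift_shift: "(y \<circ>\<^sub>p [:-1, 1:]) \<circ>\<^sub>p [:1, 1:] = (y :: real poly)"
  by (subst pcompose_assoc[symmetric]) (simp add: pcompose_pCons)

lemma recurrence_iff:
  "2 * (real j + 1)^2 * x = c * y \<longleftrightarrow> x = y * (c / (2 * (real j + 1)^2))"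
proof -
  define b where "b = 2 * (real j + 1)^2"
  have "b \<noteq> 0" by (simp add: b_def)
  then show ?thesis unfolding b_def[symmetric] by (auto simp: field_simps)
qed

lemma is_legendre_coeff:
  assumes "is_legendre k y"
  shows "coeff (y \<circ>\<^sub>p [:1, 1:]) j
    = (\<Prod>i<j. (real k * (real k + 1) - real i * (real i + 1)) / (2 * (real i + 1)^2))"
proof (induction j)
  case 0
  have "poly y 1 = 1" using assms unfolding is_legendre_def by blast
  then show ?case by (simp add: pcompose_coeff_0)
next
  case (Suc j)
  have "2 * (real j + 1)^2 * coeff (y \<circ>\<^sub>p [:1, 1:]) (Suc j)
    = (real k * (real k + 1) - real j * (real j + 1)) * coeff (y \<circ>\<^sub>p [:1, 1:]) j"
    using assms[unfolded is_legendre_def legendre_ode_iff] by blast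
  then show ?case
    unfolding prod.lessThan_Suc Suc[symmetric] by (rule recurrence_iff[THEN iffD1])
qed

lemma ex1_is_legendre: "\<exists>!y. is_legendre k y"
proof -
  define a where
    "a j = (\<Prod>i<j. (real k * (real k + 1) - real i * (real i + 1)) / (2 * (real i + 1)^2))" for j
  define e where "e = (\<Sum>j\<le>k. monom (a j) j)"
  have "a j = 0" if "j > k" for j
    unfolding a_def using that by (intro prod_zero) auto
  then have ce: "coeff e j = a j" for j
    by (auto simp: e_def coeff_sum not_le)
  have "2 * (real j + 1)^2 * a (Suc j) = (real k * (real k + 1) - real j * (real j + 1)) * a j" for j
    unfolding recurrence_iff a_def by (rule prod.lessThan_Suc)
  moreover have "a 0 = 1" by (simp add: a_def)
  ultimately have "is_legendre k (e \<circ>\<^sub>p [:-1, 1:])"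
    unfolding is_legendre_def legendre_ode_iff poly_1_eq_coeff shift_shift ce by blast
  moreover have "y = z" if "is_legendre k y" "is_legendre k z" for y z
  proof -
    have "(y - z) \<circ>\<^sub>p [:1, 1:] = 0"
      by (simp add: poly_eq_iff pcompose_diff is_legendre_coeff[OF that(1)]
          is_legendre_coeff[OF that(2)])
    then show ?thesis by (subst (asm) pcompose_eq_0_iff) auto
  qed
  ultimately show ?thesis by blast
qed

lemma is_legendre_legendre: "is_legendre k (legendre k)"
  unfolding legendre_def by (rule theI'[OF ex1_is_legendre])

lemma degree_legendre: "degree (legendre k) = k"
proof -
  let ?e = "legendre k \<circ>\<^sub>p [:1, 1:]"
  note c = is_legendre_coeff[OF is_legendre_legendre[of k]]
  have "coeff ?e j = 0" if "j > k" for j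
    unfolding c using that by (intro prod_zero) auto
  then have "degree ?e \<le> k" by (intro degree_le) auto
  moreover have "real k * (real k + 1) - real i * (real i + 1) > 0" if "i < k" for i
  proof -
    have "real i * (real i + 1) < real k * (real k + 1)"
      using that by (intro mult_strict_mono) auto
    then show ?thesis by simp
  qed
  then have "coeff ?e k \<noteq> 0"
    unfolding c by (intro less_imp_neq[THEN not_sym] prod_pos divide_pos_pos ballI) auto
  then have "degree ?e \<ge> k" by (rule le_degree)
  ultimately have "degree ?e = k" by simp
  then show ?thesis by (simp only: degree_pcompose) simp
qed

lemma legendre_nonzero: "legendre k \<noteq> 0"
proof
  assume "legendre k = 0"
  moreover have "poly (legendre k) 1 = 1"
    using is_legendre_legendre[of k] unfolding is_legendre_def by blast
  ultimately show False by simp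
qed

global_interpretation rpoly: vector_space "smult :: real \<Rightarrow> real poly \<Rightarrow> real poly"
  by unfold_locales (auto simp: smult_add_right smult_add_left)

global_interpretation rpoly_pair: vector_space_pair
  "smult :: real \<Rightarrow> real poly \<Rightarrow> real poly" "smult :: real \<Rightarrow> real poly \<Rightarrow> real poly" ..

lemma span_legendre: "rpoly.span (range legendre) = UNIV"
proof -
  have "p \<in> rpoly.span (range legendre)" if "degree p < n" for p n
    using that
  proof (induction n arbitrary: p)
    case (Suc n)
    define c where "c = coeff p n / coeff (legendre n) n"
    define q where "q = p - smult c (legendre n)"
    have L: "smult c (legendre n) \<in> rpoly.span (range legendre)"
      by (intro rpoly.span_scale rpoly.span_base) auto
    have "coeff (legendre n) n \<noteq> 0"
      using legendre_nonzero[of n] degree_legendre[of n] leading_coeff_0_iff by metis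
    then have "coeff q n = 0" by (simp add: q_def c_def)
    moreover have "degree q \<le> n"
      unfolding q_def using Suc.prems degree_legendre[of n]
      by (intro degree_diff_le) (auto intro: order_trans[OF degree_smult_le])
    ultimately have "q = 0 \<or> degree q < n"
      by (metis le_neq_implies_less leading_coeff_0_iff)
    then have "q \<in> rpoly.span (range legendre)"
      using Suc.IH rpoly.span_zero by auto
    then have "q + smult c (legendre n) \<in> rpoly.span (range legendre)"
      using L by (rule rpoly.span_add)
    then show ?case by (simp add: q_def)
  qed auto
  then show ?thesis by blast
qed

lemma independent_legendre: "\<not> rpoly.dependent (range legendre)"
  unfolding rpoly.independent_explicit_finite_subsets
proof (intro allI impI)
  fix A u
  assume A: "A \<subseteq> range legendre" "finite A" and s: "(\<Sum>v\<in>A. smult (u v) v) = 0"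
  show "\<forall>v\<in>A. u v = 0"
  proof (rule ccontr)
    define N where "N = {v \<in> A. u v \<noteq> 0}"
    assume "\<not> (\<forall>v\<in>A. u v = 0)"
    then have N: "N \<noteq> {}" "finite N" using A by (auto simp: N_def)
    then have "Max (degree ` N) \<in> degree ` N" by (intro Max_in) auto
    then obtain w where w: "w \<in> N" "degree w = Max (degree ` N)" by auto
    have le: "degree v \<le> degree w" if "v \<in> N" for v
      using that N w by auto
    have neq: "degree v \<noteq> degree w" if v: "v \<in> A" "v \<noteq> w" for v
    proof -
      obtain i j where "v = legendre i" "w = legendre j"
        using v(1) w(1) A(1) by (metis (no_types, lifting) N_def imageE mem_Collect_eq subsetD)
      then show ?thesis using v(2) by (auto simp: degree_legendre)
    qed
    have "u v * coeff v (degree w) = 0" if "v \<in> A - {w}" for v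
    proof (cases "u v = 0")
      case False
      then have "degree v < degree w" using le[of v] neq[of v] that by (simp add: N_def)
      then show ?thesis by (simp add: coeff_eq_0)
    qed auto
    then have "(\<Sum>v\<in>A - {w}. u v * coeff v (degree w)) = 0" by (intro sum.neutral) auto
    moreover have "coeff (\<Sum>v\<in>A. smult (u v) v) (degree w)
        = u w * coeff w (degree w) + (\<Sum>v\<in>A - {w}. u v * coeff v (degree w))"
    proof -
      have "w \<in> A" using w by (simp add: N_def)
      then show ?thesis by (simp add: coeff_sum sum.remove[OF A(2)])
    qed
    ultimately have "u w * coeff w (degree w) = 0" using s by simp
    moreover have "u w \<noteq> 0" "w \<in> range legendre"
      using w(1) A(1) by (simp_all add: N_def subsetD)
    ultimately show False
      using legendre_nonzero by (metis imageE leading_coeff_0_iff mult_eq_0_iff)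
  qed
qed

lemma ex1_legendre_operator:
  "\<exists>!T. Vector_Spaces.linear smult smult T \<and> (\<forall>k. T (legendre k) = smult (\<gamma> k) (legendre k))"
proof -
  obtain T where T: "Vector_Spaces.linear smult smult T"
    and "\<forall>p\<in>range legendre. T p = smult (\<gamma> (degree p)) p"
    using rpoly_pair.linear_independent_extend[OF independent_legendre,
        of "\<lambda>p. smult (\<gamma> (degree p)) p"] by blast
  then have Tl: "T (legendre k) = smult (\<gamma> k) (legendre k)" for k
    by (simp add: degree_legendre)
  show ?thesis
  proof (rule ex1I[of _ T])
    show "Vector_Spaces.linear smult smult T \<and> (\<forall>k. T (legendre k) = smult (\<gamma> k) (legendre k))"
      using T Tl by (intro conjI allI)
  next
    fix S
    assume S: "Vector_Spaces.linear smult smult S \<and> (\<forall>k. S (legendre k) = smult (\<gamma> k) (legendre k))"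
    have eq: "S b = T b" if "b \<in> range legendre" for b
    proof -
      from that obtain k where "b = legendre k" by (rule imageE)
      then show ?thesis using S by (simp only: Tl)
    qed
    show "S = T"
    proof
      fix p
      have p: "p \<in> rpoly.span (range legendre)"
        unfolding span_legendre by (rule UNIV_I)
      show "S p = T p"
        by (rule rpoly_pair.linear_eq_on[OF conjunct1[OF S] T p eq])
    qed
  qed
qed

end

theory Submission
  imports Defs "HOL-Computational_Algebra.Fundamental_Theorem_Algebra"
begin

text \<open>
  Write \<open>X = x^2 + x\<close> and \<open>p = a(X) + b(X) (2 x + 1)\<close>; the claim is \<open>b = 0\<close>.
  Apply the multiplier operator to \<open>u^n\<close>, where \<open>u = (1 - x) / 2\<close>. The part \<open>a(X)\<close> is a polynomial
  in the Legendre differential operator, hence contributes to the coefficient of \<open>u^j\<close> only if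
  \<open>n - j\<close> is bounded. The part \<open>b(X) (2 x + 1)\<close> is nonlocal: after a normalization depending on \<open>n\<close>,
  the coefficient of \<open>u^j\<close> tends, as \<open>n \<rightarrow> \<infinity>\<close>, to that of \<open>u^j\<close> in the result of
  applying the differential operator \<open>b\<close> to \<open>(1 - u)^(-3/2)\<close>.
  As the image of \<open>u^n\<close> is hyperbolic, these limits satisfy Newton's inequalities, which force the
  coefficients of an entire function. But the limit power series has a singularity at \<open>u = 1\<close> unless
  \<open>b = 0\<close>.
\<close>

subsection \<open>Newton's inequalities for hyperbolic polynomials\<close>

lemma poly_of_real_simps:
  fixes p q :: "real poly"
  shows "poly (map_poly complex_of_real (p + q)) z
      = poly (map_poly complex_of_real p) z + poly (map_poly complex_of_real q) z"
    and "poly (map_poly complex_of_real (smult c p)) z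
      = complex_of_real c * poly (map_poly complex_of_real p) z"
    and "poly (map_poly complex_of_real (pCons c p)) z
      = complex_of_real c + z * poly (map_poly complex_of_real p) z"
    and "poly (map_poly complex_of_real (p * q)) z
      = poly (map_poly complex_of_real p) z * poly (map_poly complex_of_real q) z"
    and "poly (map_poly complex_of_real (p \<circ>\<^sub>p q)) z
      = poly (map_poly complex_of_real p) (poly (map_poly complex_of_real q) z)"
proof -
  show add: "poly (map_poly complex_of_real (p + q)) z
      = poly (map_poly complex_of_real p) z + poly (map_poly complex_of_real q) z" for p q
    by (simp add: poly_eq_iff coeff_map_poly flip: poly_add)
       (rule arg_cong[where f = "\<lambda>r. poly r z"], simp add: poly_eq_iff coeff_map_poly)
  show sm: "poly (map_poly complex_of_real (smult c p)) z
      = complex_of_real c * poly (map_poly complex_of_real p) z" for c p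
    by (simp add: map_poly_smult)
  show pC: "poly (map_poly complex_of_real (pCons c p)) z
      = complex_of_real c + z * poly (map_poly complex_of_real p) z" for c p z
    by (simp add: map_poly_pCons)
  show mu: "poly (map_poly complex_of_real (p * q)) z
      = poly (map_poly complex_of_real p) z * poly (map_poly complex_of_real q) z" for p q
    by (induction p) (simp_all add: add sm pC algebra_simps)
  show "poly (map_poly complex_of_real (p \<circ>\<^sub>p q)) z
      = poly (map_poly complex_of_real p) (poly (map_poly complex_of_real q) z)"
    by (induction p) (simp_all add: pcompose_pCons add sm pC mu)
qed

lemma hyperbolic_mult: "hyperbolic p \<Longrightarrow> hyperbolic q \<Longrightarrow> hyperbolic (p * q)"
  by (auto simp: hyperbolic_def poly_of_real_simps)

lemma complex_of_real_affine_imp_real: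
  assumes "complex_of_real a + z * complex_of_real c \<in> \<real>" "c \<noteq> 0"
  shows "z \<in> \<real>"
  using assms by (simp add: complex_is_Real_iff)

lemma hyperbolic_linear: "hyperbolic [:a, c:]"
proof (cases "c = 0")
  case False
  have "z \<in> \<real>" if "complex_of_real a + z * complex_of_real c = 0" for z
    using complex_of_real_affine_imp_real[of a z c] that False by simp
  then show ?thesis
    by (auto simp: hyperbolic_def poly_of_real_simps)
qed (auto simp: hyperbolic_def poly_of_real_simps)

lemma hyperbolic_power: "hyperbolic p \<Longrightarrow> hyperbolic (p ^ n)"
  using hyperbolic_linear[of 1 0]
  by (induction n) (simp_all add: hyperbolic_mult one_pCons)

lemma hyperbolic_pcompose_linear:
  assumes "hyperbolic p" "c \<noteq> 0"
  shows "hyperbolic (p \<circ>\<^sub>p [:a, c:])"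
proof (cases "p = 0")
  case False
  show ?thesis
    unfolding hyperbolic_def
  proof (intro disjI2 allI impI)
    fix z
    assume "poly (map_poly complex_of_real (p \<circ>\<^sub>p [:a, c:])) z = 0"
    then have "complex_of_real a + z * complex_of_real c \<in> \<real>"
      using assms(1) False by (simp add: hyperbolic_def poly_of_real_simps)
    then show "z \<in> \<real>"
      using assms(2) by (rule complex_of_real_affine_imp_real)
  qed
qed (simp add: hyperbolic_def)

text \<open>The fundamental theorem of algebra yields a root, hyperbolicity makes it real, and the
  cofactor is hyperbolic again. The zero polynomial falls under \<open>const\<close>.\<close>

lemma hyperbolic_induct [consumes 1, case_names const root]:
  assumes "hyperbolic p"
    and const: "\<And>c. P [:c:]"
    and root: "\<And>r q. hyperbolic q \<Longrightarrow> P q \<Longrightarrow> P ([:-r, 1:] * q)"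
  shows "P p"
  using assms(1)
proof (induction "degree p" arbitrary: p)
  case 0
  then show ?case using const by (metis degree_eq_zeroE)
next
  case (Suc n)
  let ?C = "map_poly complex_of_real"
  have "degree (?C p) = Suc n"
    using Suc.hyps(2) by (simp add: degree_map_poly)
  then have "\<not> constant (poly (?C p))" by (simp add: constant_degree)
  then obtain z where z: "poly (?C p) z = 0"
    using fundamental_theorem_of_algebra by blast
  have "p \<noteq> 0" using Suc.hyps(2) by auto
  then have "z \<in> \<real>" using z Suc.prems by (auto simp: hyperbolic_def)
  then obtain r where r: "z = of_real r" by (rule Reals_cases)
  have "poly (?C p) (of_real r) = of_real (poly p r)"
    by (induction p) (simp_all add: poly_of_real_simps)
  then have "poly p r = 0" using z r by simp
  then obtain q where q: "p = [:-r, 1:] * q"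
    by (metis poly_eq_0_iff_dvd dvdE)
  then have "q \<noteq> 0" using \<open>p \<noteq> 0\<close> by auto
  then have "degree p = Suc (degree q)"
    unfolding q by (subst degree_mult_eq) auto
  then have "n = degree q" using Suc.hyps(2) by simp
  moreover have "hyperbolic q"
    using Suc.prems \<open>p \<noteq> 0\<close> unfolding hyperbolic_def q
    by (simp only: poly_of_real_simps(4) mult_eq_0_iff) blast
  ultimately have "P q" by (rule Suc.hyps(1))
  then show ?case
    unfolding q using \<open>hyperbolic q\<close> by (intro root)
qed

text \<open>As in the Gauss--Lucas theorem, the logarithmic derivative maps the upper half plane to the
  closed lower one and vice versa; it vanishes at a nonreal point for constants only.\<close>
lemma hyperbolic_log_deriv:
  assumes "hyperbolic p" "p \<noteq> 0" "Im z \<noteq> 0"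
  defines "w \<equiv> poly (map_poly complex_of_real (pderiv p)) z / poly (map_poly complex_of_real p) z"
  shows "Im w * Im z \<le> 0 \<and> (pderiv p \<noteq> 0 \<longrightarrow> Im w * Im z < 0)"
  using assms(1,2) unfolding w_def
proof (induction rule: hyperbolic_induct)
  case (const c)
  then show ?case by (simp add: pderiv_pCons)
next
  case (root r q)
  let ?C = "\<lambda>p. poly (map_poly complex_of_real p) z"
  have q: "q \<noteq> 0" using root.prems by auto
  then have "?C q \<noteq> 0"
    using root.hyps assms(3) by (auto simp: hyperbolic_def complex_is_Real_iff)
  moreover have zr: "z - of_real r \<noteq> 0" using assms(3) by auto
  ultimately have "?C (pderiv ([:-r, 1:] * q)) / ?C ([:-r, 1:] * q)
      = inverse (z - of_real r) + ?C (pderiv q) / ?C q"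
    by (simp only: pderiv_mult pderiv_pCons poly_of_real_simps)
       (simp add: poly_of_real_simps field_simps)
  \<comment> \<open>A real root adds a term whose imaginary part has the sign opposite to that of
    \<open>Im z\<close>, so a single root already gives strictness.\<close>
  moreover have "Im (inverse (z - of_real r)) * Im z < 0"
    using zr assms(3) by (simp add: divide_neg_pos sum_power2_gt_zero_iff flip: power2_eq_square)
  ultimately show ?case
    using root.IH[OF q] by (simp only: plus_complex.sel distrib_right) linarith
qed

text \<open>At a nonreal zero of a nonzero \<open>pderiv p\<close> the logarithmic derivative would
  be 0, which the strict part of \<open>hyperbolic_log_deriv\<close> excludes.\<close>

lemma hyperbolic_pderiv:
  assumes "hyperbolic p"
  shows "hyperbolic (pderiv p)"
proof (cases "pderiv p = 0")
  case False
  then have "p \<noteq> 0" by auto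
  then show ?thesis
    using hyperbolic_log_deriv[OF assms \<open>p \<noteq> 0\<close>] False
    unfolding hyperbolic_def complex_is_Real_iff
    by (metis div_0 mult_zero_left order_less_irrefl zero_complex.sel(2))
qed (simp add: hyperbolic_def)

text \<open>Away from the zeros, p'^2 - p p'' is p^2 times the sum of (x - r)^(-2) over the roots r.
  Adding one root at a time avoids the division.\<close>

lemma hyperbolic_laguerre:
  assumes "hyperbolic p"
  shows "poly p x * poly (pderiv (pderiv p)) x \<le> (poly (pderiv p) x)\<^sup>2"
  using assms
proof (induction rule: hyperbolic_induct)
  case (const c)
  then show ?case by (simp add: pderiv_pCons)
next
  case (root r q)
  let ?q = "poly q x" let ?q' = "poly (pderiv q) x" let ?q'' = "poly (pderiv (pderiv q)) x"
  have "(poly (pderiv ([:-r, 1:] * q)) x)\<^sup>2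
      - poly ([:-r, 1:] * q) x * poly (pderiv (pderiv ([:-r, 1:] * q))) x
      = ?q\<^sup>2 + (x - r)\<^sup>2 * (?q'\<^sup>2 - ?q * ?q'')"
    by (simp add: pderiv_mult pderiv_pCons pderiv_add pderiv_diff pderiv_smult
        power2_eq_square algebra_simps)
  moreover have "\<dots> \<ge> 0" using root.IH by simp
  ultimately show ?case by linarith
qed

text \<open>This is Laguerre's inequality at 0 for the j-th derivative. In contrast to the sharp
  form of Newton's inequalities the degree of \<open>p\<close> does not occur, so the inequality can
  be carried to a limit of polynomials of growing degree.\<close>

lemma hyperbolic_newton:
  assumes "hyperbolic p"
  shows "real (j + 2) * (coeff p j * coeff p (j + 2)) \<le> real (j + 1) * (coeff p (j + 1))\<^sup>2"
  using assms
proof (induction j arbitrary: p)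
  case 0
  have "coeff (pderiv p) 0 = coeff p 1" "coeff (pderiv (pderiv p)) 0 = 2 * coeff p 2"
    by (simp_all add: coeff_pderiv numeral_2_eq_2)
  then show ?case
    using hyperbolic_laguerre[OF 0, of 0] by (simp add: poly_0_coeff_0 mult_ac numeral_2_eq_2)
next
  case (Suc j)
  have "real (j + 1) * real (j + 2) * real (j + 3) * (coeff p (j + 1) * coeff p (j + 3))
      \<le> real (j + 1) * (real (j + 2) * real (j + 2)) * (coeff p (j + 2))\<^sup>2"
    using Suc.IH[OF hyperbolic_pderiv[OF Suc.prems]]
    by (simp add: coeff_pderiv numeral_eq_Suc algebra_simps power2_eq_square)
  then have "real (j + 1) * real (j + 2) * (real (j + 3) * (coeff p (j + 1) * coeff p (j + 3)))
      \<le> real (j + 1) * real (j + 2) * (real (j + 2) * (coeff p (j + 2))\<^sup>2)"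
    by (simp only: mult.assoc)
  then have "real (j + 3) * (coeff p (j + 1) * coeff p (j + 3))
      \<le> real (j + 2) * (coeff p (j + 2))\<^sup>2"
    by (subst (asm) mult_le_cancel_left_pos) (auto intro!: mult_pos_pos)
  then show ?case by (simp add: numeral_eq_Suc)
qed

section \<open>Coefficient ratios tending to 1 against Newton's inequalities\<close>

lemma poly_shift_ratio_tendsto_1:
  fixes R :: "real poly"
  assumes "R \<noteq> 0"
  shows "(\<lambda>j. poly R (real (Suc j)) / poly R (real j)) \<longlonglongrightarrow> 1"
proof -
  let ?d = "degree R"
  have at_inf: "filterlim real at_infinity sequentially"
    by (rule filterlim_at_top_imp_at_infinity[OF filterlim_real_sequentially])
  have "(\<lambda>j. poly R (real j) / real j ^ ?d) \<longlonglongrightarrow> lead_coeff R"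
    by (rule filterlim_compose[OF poly_divide_tendsto_aux at_inf])
  note lim = this LIMSEQ_Suc[OF this]
  have "(\<lambda>j. (poly R (real (Suc j)) / real (Suc j) ^ ?d) / (poly R (real j) / real j ^ ?d)
      * (real (Suc j) / real j) ^ ?d) \<longlonglongrightarrow> lead_coeff R / lead_coeff R * 1 ^ ?d"
    using assms by (intro tendsto_mult tendsto_divide tendsto_power lim LIMSEQ_Suc_n_over_n) auto
  then have L: "(\<lambda>j. (poly R (real (Suc j)) / real (Suc j) ^ ?d) / (poly R (real j) / real j ^ ?d)
      * (real (Suc j) / real j) ^ ?d) \<longlonglongrightarrow> 1"
    using assms by simp
  have "\<forall>\<^sub>F j in sequentially. (poly R (real (Suc j)) / real (Suc j) ^ ?d)
      / (poly R (real j) / real j ^ ?d) * (real (Suc j) / real j) ^ ?d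
    = poly R (real (Suc j)) / poly R (real j)"
    using eventually_gt_at_top[of 0]
    by eventually_elim (simp add: power_divide field_simps del: of_nat_Suc)
  then show ?thesis by (rule Lim_transform_eventually[OF L])
qed

text \<open>Newton's inequalities for a power series say that (j + 1) g_(j+1) / g_j is decreasing,
  which is impossible if g_(j+1) / g_j tends to 1.\<close>
lemma newton_inequalities_ratio_not_1:
  fixes g :: "nat \<Rightarrow> real"
  assumes lim: "(\<lambda>j. g (Suc j) / g j) \<longlonglongrightarrow> 1"
    and newton: "\<And>j. real (j + 2) * (g j * g (j + 2)) \<le> real (j + 1) * (g (j + 1))\<^sup>2"
  shows False
proof -
  define r where "r j = g (Suc j) / g j" for j
  have "\<forall>\<^sub>F j in sequentially. r j > 1/2"
    using order_tendstoD(1)[OF lim, of "1/2"] by (simp add: r_def)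
  then obtain N where N: "r j > 1/2" if "j \<ge> N" for j
    by (auto simp: eventually_sequentially)
  have decr: "real (Suc j + 1) * r (Suc j) \<le> real (j + 1) * r j" if "j \<ge> N" for j
  proof -
    have nz: "g j \<noteq> 0" "g (Suc j) \<noteq> 0" "r j > 0"
      using N[of j] N[of "Suc j"] that by (auto simp: r_def intro: less_trans[of 0 "1/2"])
    have "real (j + 2) * (g j * g (j + 2)) / (g (Suc j))\<^sup>2 \<le> real (j + 1)"
      using newton[of j] nz by (simp add: divide_le_eq)
    also have "real (j + 2) * (g j * g (j + 2)) / (g (Suc j))\<^sup>2 = real (j + 2) * r (Suc j) / r j"
      using nz by (simp add: r_def power2_eq_square)
    finally show ?thesis using nz(3) by (simp add: divide_le_eq mult_ac)
  qed
  have bound: "real (j + 1) * r j \<le> real (N + 1) * r N" if "j \<ge> N" for j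
    using that
  proof (induction j rule: dec_induct)
    case (step n)
    then show ?case using decr[of n] by simp
  qed simp
  \<comment> \<open>By \<open>bound\<close> the numbers (k + 1) r_k are bounded for k at least
    \<open>N\<close>, while \<open>N\<close> makes them at least k / 2; this \<open>j\<close> is
    large enough for the contradiction.\<close>
  obtain j where j: "real j > 2 * (real (N + 1) * r N)" using reals_Archimedean2 by blast
  define k where "k = max j N"
  have "real k / 2 \<le> real (k + 1) * r k"
    using N[of k] mult_mono[of "real k" "real (k + 1)" "1/2" "r k"] by (simp add: k_def)
  also have "\<dots> \<le> real (N + 1) * r N" by (rule bound) (simp add: k_def)
  finally show False using j by (simp add: k_def)
qed

text \<open>The reflection x -> -1 - x fixes x^2 + x and negates 2 x + 1, so these are the even and
  odd parts of \<open>p\<close>. Division by x^2 + x lowers the degree, and a remainder c + d x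
  equals (c - d/2) + (d/2) (2 x + 1).\<close>

lemma poly_even_odd_decomposition:
  fixes p :: "real poly"
  shows "\<exists>a b. p = a \<circ>\<^sub>p [:0, 1, 1:] + (b \<circ>\<^sub>p [:0, 1, 1:]) * [:1, 2:]"
proof (induction "degree p" arbitrary: p rule: less_induct)
  case less
  let ?X = "[:0, 1, 1 :: real:]"
  define q r where "q = p div ?X" and "r = p mod ?X"
  have p: "p = ?X * q + r" unfolding q_def r_def by (rule mult_div_mod_eq[symmetric])
  have "r = 0 \<or> degree r < degree ?X" unfolding r_def by (rule degree_mod_less) simp
  then have "degree r \<le> 1" by auto
  then have "r = [:coeff r 0, coeff r 1:]"
    by (intro poly_eqI) (auto simp: coeff_pCons coeff_eq_0 split: nat.splits)
  then obtain c d where r: "r = [:c, d:]" by blast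
  show ?case
  proof (cases "q = 0")
    case True
    then have "p = [:c - d / 2:] \<circ>\<^sub>p ?X + ([:d / 2:] \<circ>\<^sub>p ?X) * [:1, 2:]"
      using p r by simp
    then show ?thesis by blast
  next
    case False
    then have "degree q < degree p"
      unfolding q_def using div_poly_less[of p ?X]
      by (intro degree_div_less) (auto intro: Nat.gr0I)
    then obtain a b where "q = a \<circ>\<^sub>p ?X + (b \<circ>\<^sub>p ?X) * [:1, 2:]"
      using less by blast
    then have "p = pCons (c - d / 2) a \<circ>\<^sub>p ?X + (pCons (d / 2) b \<circ>\<^sub>p ?X) * [:1, 2:]"
      unfolding p r by (simp add: pcompose_pCons algebra_simps)
    then show ?thesis by blast
  qed
qed

subsection \<open>Matrices of Legendre multipliers\<close>

text \<open>In powers of \<open>u = (1 - x) / 2\<close> the Legendre operator is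
  \<open>u^n \<mapsto> n (n + 1) u^n - n^2 u^(n - 1)\<close>. The predicate describes the triangular matrices
  (row \<open>n\<close> is the image of \<open>u^n\<close>) that commute with it and have diagonal \<open>p\<close>: the matrix of the
  operator \<open>P_k \<mapsto> p(k) P_k\<close>.\<close>
definition legendre_matrix :: "(nat \<Rightarrow> nat \<Rightarrow> real) \<Rightarrow> real poly \<Rightarrow> bool" where
  "legendre_matrix A p \<longleftrightarrow>
     (\<forall>n j. n < j \<longrightarrow> A n j = 0) \<and> (\<forall>n. A n n = poly p (real n)) \<and>
     (\<forall>n j. real n * (real n + 1) * A n j - (real n)\<^sup>2 * A (n - 1) j
        = real j * (real j + 1) * A n j - (real j + 1)\<^sup>2 * A n (Suc j))"

lemma legendre_matrixD:
  assumes "legendre_matrix A p"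
  shows "n < j \<Longrightarrow> A n j = 0" "A n n = poly p (real n)"
    "real n * (real n + 1) * A n j - (real n)\<^sup>2 * A (n - 1) j
        = real j * (real j + 1) * A n j - (real j + 1)\<^sup>2 * A n (Suc j)"
  using assms unfolding legendre_matrix_def by blast+

lemma eigenvalue_less: "j < n \<Longrightarrow> real j * (real j + 1) < real n * (real n + 1)"
  by (intro mult_strict_mono) auto

text \<open>Induction on the distance from the diagonal: since the eigenvalues n (n + 1) and j (j +
  1) differ, the recurrence determines the entry (n, j) from (n - 1, j) and (n, j + 1), which are
  one step closer.\<close>

lemma legendre_matrix_unique:
  assumes A: "legendre_matrix A p" and B: "legendre_matrix B p"
  shows "A n j = B n j"
proof (cases "n < j")
  case True
  then show ?thesis using legendre_matrixD(1)[OF A] legendre_matrixD(1)[OF B] by simp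
next
  case False
  then obtain d where "n = j + d" using le_Suc_ex by (metis not_less)
  then show ?thesis
  proof (induction d arbitrary: n j)
    case 0
    then show ?case using legendre_matrixD(2)[OF A] legendre_matrixD(2)[OF B] by simp
  next
    case (Suc d)
    have "A (n - 1) j = B (n - 1) j" "A n (Suc j) = B n (Suc j)"
      using Suc.IH[of "n - 1" j] Suc.IH[of n "Suc j"] Suc.prems by simp_all
    then have "(real n * (real n + 1) - real j * (real j + 1)) * A n j
        = (real n * (real n + 1) - real j * (real j + 1)) * B n j"
      using legendre_matrixD(3)[OF A, of n j] legendre_matrixD(3)[OF B, of n j]
      unfolding left_diff_distrib by simp
    moreover have "real n * (real n + 1) - real j * (real j + 1) \<noteq> 0"
      using eigenvalue_less[of j n] Suc.prems by simp
    ultimately show ?case by simp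
  qed
qed

lemma legendre_matrix_add_smult:
  fixes c :: real
  assumes A: "legendre_matrix A p" and B: "legendre_matrix B q"
  shows "legendre_matrix (\<lambda>n j. c * A n j + B n j) (smult c p + q)"
  unfolding legendre_matrix_def
proof (intro conjI allI impI)
  fix n j
  show "real n * (real n + 1) * (c * A n j + B n j) - (real n)\<^sup>2 * (c * A (n - 1) j + B (n - 1) j)
      = real j * (real j + 1) * (c * A n j + B n j)
        - (real j + 1)\<^sup>2 * (c * A n (Suc j) + B n (Suc j))" (is "?l = ?r")
  proof -
    have "?l = c * (real n * (real n + 1) * A n j - (real n)\<^sup>2 * A (n - 1) j)
        + (real n * (real n + 1) * B n j - (real n)\<^sup>2 * B (n - 1) j)"
      by (simp add: algebra_simps)
    also have "\<dots> = ?r"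
      unfolding legendre_matrixD(3)[OF A] legendre_matrixD(3)[OF B] by (simp add: algebra_simps)
    finally show ?thesis .
  qed
qed (simp_all add: legendre_matrixD(1,2)[OF A] legendre_matrixD(1,2)[OF B])

text \<open>The action of the Legendre differential operator on the coefficients of powers of
  u.\<close>

definition legendre_op :: "(nat \<Rightarrow> real) \<Rightarrow> nat \<Rightarrow> real" where
  "legendre_op g j = real j * (real j + 1) * g j - (real j + 1)\<^sup>2 * g (Suc j)"

text \<open>The Legendre operator commutes with itself, so composition with it keeps the commutation
  and multiplies the diagonal by the eigenvalue n (n + 1). By \<open>eq\<close> the composition can
  also be computed on the row index.\<close>

lemma legendre_matrix_op:
  assumes A: "legendre_matrix A p"
  shows "legendre_matrix (\<lambda>n. legendre_op (A n)) ([:0, 1, 1:] * p)"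
proof -
  have eq: "legendre_op (A n) j = real n * (real n + 1) * A n j - (real n)\<^sup>2 * A (n - 1) j" for n j
    using legendre_matrixD(3)[OF A, of n j] by (simp add: legendre_op_def)
  show ?thesis
    unfolding legendre_matrix_def
  proof (intro conjI allI impI)
    fix n j
    have "real n * (real n + 1) * legendre_op (A n) j - (real n)\<^sup>2 * legendre_op (A (n - 1)) j
        = real j * (real j + 1) * (real n * (real n + 1) * A n j - (real n)\<^sup>2 * A (n - 1) j)
          - (real j + 1)\<^sup>2 * (real n * (real n + 1) * A n (Suc j) - (real n)\<^sup>2 * A (n - 1) (Suc j))"
      unfolding legendre_op_def by (simp add: algebra_simps)
    also have "\<dots> = real j * (real j + 1) * legendre_op (A n) j
          - (real j + 1)\<^sup>2 * legendre_op (A n) (Suc j)"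
      unfolding eq ..
    finally show "real n * (real n + 1) * legendre_op (A n) j
        - (real n)\<^sup>2 * legendre_op (A (n - 1)) j
        = real j * (real j + 1) * legendre_op (A n) j
          - (real j + 1)\<^sup>2 * legendre_op (A n) (Suc j)" .
  next
    fix n
    show "legendre_op (A n) n = poly ([:0, 1, 1:] * p) (real n)"
      using legendre_matrixD(1,2)[OF A] by (simp add: legendre_op_def algebra_simps)
  qed (simp add: legendre_op_def legendre_matrixD(1)[OF A])
qed

lemma legendre_matrix_id: "legendre_matrix (\<lambda>n j. if n = j then 1 else 0) 1"
  unfolding legendre_matrix_def by (auto simp: of_nat_diff power2_eq_square)

lemma legendre_matrix_zero: "legendre_matrix (\<lambda>n j. 0) 0"
  unfolding legendre_matrix_def by simp

section \<open>The matrix of the multiplier 2 k + 1\<close>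

text \<open>\<open>wgt j\<close> is the coefficient of \<open>u^j\<close> in \<open>(1 - u)^(-3/2)\<close>.\<close>
definition wgt :: "nat \<Rightarrow> real" where
  "wgt j = (\<Prod>i<j. (real i + 3/2) / (real i + 1))"

text \<open>The formula for the operator \<open>P_k \<mapsto> (2 k + 1) P_k\<close> comes from a well-poised hypergeometric
  sum. It says that \<open>(1 - u y)^(-1/2)\<close> is mapped to \<open>(1 - u y)^(-3/2) (1 - y)^(1/2)\<close>.\<close>
definition odd_matrix :: "nat \<Rightarrow> nat \<Rightarrow> real" where
  "odd_matrix n j = (if n < j then 0 else
     (\<Prod>i<n. (real i + 1) / (real i + 1/2)) * wgt j * (\<Prod>i<n - j. (real i - 1/2) / (real i + 1)))"

lemma wgt_Suc: "(real j + 1) * wgt (Suc j) = (real j + 3/2) * wgt j"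
  by (simp add: wgt_def)

lemma wgt_pos: "wgt j > 0"
  unfolding wgt_def by (intro prod_pos) auto

lemma real_neq_half: "real i \<noteq> 1/2"
proof
  assume "real i = 1/2"
  then have "real (2 * i) = real 1" by simp
  then have "2 * i = 1" by (simp only: of_nat_eq_iff)
  then show False by presburger
qed

lemma odd_matrix_nonzero: "j \<le> n \<Longrightarrow> odd_matrix n j \<noteq> 0"
proof -
  have "real i - 1/2 \<noteq> 0" for i using real_neq_half[of i] by simp
  moreover assume "j \<le> n"
  ultimately show ?thesis
    using wgt_pos[of j] by (auto simp: odd_matrix_def simp del: of_nat_Suc)
qed

text \<open>The step to \<open>Suc j\<close> drops the last factor (n - j - 3/2) / (n - j) of the
  third product and multiplies \<open>wgt j\<close> by (j + 3/2) / (j + 1).\<close>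

lemma odd_matrix_Suc_right:
  assumes "j < n"
  shows "(real j + 1) * (real n - real j - 3/2) * odd_matrix n (Suc j)
    = (real j + 3/2) * (real n - real j) * odd_matrix n j"
proof -
  obtain m where n: "n = Suc (j + m)" using less_imp_Suc_add[OF assms] by blast
  define F W where "F = (\<Prod>i<n. (real i + 1) / (real i + 1/2))"
    and "W = (\<Prod>i<m. (real i - 1/2) / (real i + 1))"
  have W: "(\<Prod>i<Suc m. (real i - 1/2) / (real i + 1)) = W * ((real m - 1/2) / (real m + 1))"
    by (simp add: W_def)
  have e: "odd_matrix n (Suc j) = F * wgt (Suc j) * W"
    "odd_matrix n j = F * wgt j * (W * ((real m - 1/2) / (real m + 1)))"
    unfolding W[symmetric] F_def W_def by (simp_all add: odd_matrix_def n Suc_diff_le)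
  have "(real j + 1) * (real n - real j - 3/2) * odd_matrix n (Suc j)
      = F * W * (real m - 1/2) * ((real j + 1) * wgt (Suc j))"
    unfolding e by (simp add: n algebra_simps)
  also have "\<dots> = (real j + 3/2) * (real n - real j) * odd_matrix n j"
    unfolding wgt_Suc e by (simp add: n field_simps)
  finally show ?thesis .
qed

text \<open>The step to \<open>n - 1\<close> drops the last factors n / (n - 1/2) and (n - j - 3/2)
  / (n - j) of the first and third products.\<close>

lemma odd_matrix_pred_left:
  assumes "j < n"
  shows "real n * (real n - real j - 3/2) * odd_matrix (n - 1) j
    = (real n - 1/2) * (real n - real j) * odd_matrix n j"
proof -
  obtain m where n: "n = Suc (j + m)" using less_imp_Suc_add[OF assms] by blast
  define F W where "F = (\<Prod>i<j + m. (real i + 1) / (real i + 1/2))"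
    and "W = (\<Prod>i<m. (real i - 1/2) / (real i + 1))"
  have W: "(\<Prod>i<Suc m. (real i - 1/2) / (real i + 1)) = W * ((real m - 1/2) / (real m + 1))"
    by (simp add: W_def)
  have F: "(\<Prod>i<Suc (j + m). (real i + 1) / (real i + 1/2)) = F * (real n / (real n - 1/2))"
    by (simp add: F_def n add_ac)
  have e: "odd_matrix (n - 1) j = F * wgt j * W"
    "odd_matrix n j = F * (real n / (real n - 1/2)) * wgt j * (W * ((real m - 1/2) / (real m + 1)))"
    unfolding W[symmetric] F[symmetric] unfolding F_def W_def
    by (simp_all add: odd_matrix_def n Suc_diff_le)
  have nj: "real n - real j = real m + 1" by (simp add: n)
  have "(real n - 1/2) * (real n - real j) * odd_matrix n j
      = ((real n - 1/2) * (real n / (real n - 1/2))) * ((real m + 1) * ((real m - 1/2) / (real m + 1)))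
         * (F * wgt j * W)"
    unfolding e nj by (simp only: mult_ac)
  also have "(real n - 1/2) * (real n / (real n - 1/2)) = real n"
    using real_neq_half[of n] by simp
  also have "(real m + 1) * ((real m - 1/2) / (real m + 1)) = real n - real j - 3/2"
    unfolding nj by (simp add: field_simps)
  finally show ?thesis unfolding e by simp
qed

text \<open>The third product is empty and the other two telescope: the factors (i + 3/2) / (i +
  1/2) leave (n + 1/2) / (1/2).\<close>

lemma odd_matrix_diag: "odd_matrix n n = 2 * real n + 1"
proof -
  have "(\<Prod>i<n. (real i + 1) / (real i + 1/2)) * wgt n = 2 * real n + 1"
  proof (induction n)
    case (Suc n)
    have "(\<Prod>i<Suc n. (real i + 1) / (real i + 1/2)) * wgt (Suc n)
       = ((\<Prod>i<n. (real i + 1) / (real i + 1/2)) * wgt n)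
          * ((real n + 1) / (real n + 1/2) * ((real n + 3/2) / (real n + 1)))"
      by (simp add: wgt_def)
    also have "\<dots> = 2 * real (Suc n) + 1"
      unfolding Suc by (simp add: divide_simps) (simp add: algebra_simps)
    finally show ?case .
  qed (simp add: wgt_def)
  then show ?thesis by (simp add: odd_matrix_def)
qed

text \<open>Below the diagonal, multiplication by the nonzero half-integer n - j - 3/2 lets the two
  contiguous relations express every entry through \<open>odd_matrix n j\<close>; a polynomial
  identity remains.\<close>

lemma legendre_matrix_odd: "legendre_matrix odd_matrix [:1, 2:]"
  unfolding legendre_matrix_def
proof (intro conjI allI impI)
  fix n j :: nat
  consider "n < j" | "n = j" | "j < n" by linarith
  then show "real n * (real n + 1) * odd_matrix n j - (real n)\<^sup>2 * odd_matrix (n - 1) j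
        = real j * (real j + 1) * odd_matrix n j - (real j + 1)\<^sup>2 * odd_matrix n (Suc j)"
  proof cases
    case 1
    then show ?thesis by (simp add: odd_matrix_def)
  next
    case 2
    \<comment> \<open>For n = 0 the truncated \<open>n - 1\<close> is 0 again, but its term carries
      the factor n^2 = 0.\<close>
    then show ?thesis by (cases "j = 0") (auto simp: odd_matrix_def)
  next
    case 3
    let ?d = "real n - real j - 3/2"
    have d: "?d \<noteq> 0"
    proof -
      have "?d = real (n - Suc j) - 1/2" using 3 by (simp add: of_nat_diff)
      then show ?thesis using real_neq_half[of "n - Suc j"] by (simp only: right_minus_eq not_False_eq_True)
    qed
    have "?d * (real n * (real n + 1) * odd_matrix n j - (real n)\<^sup>2 * odd_matrix (n - 1) j)
        = ?d * (real n * (real n + 1)) * odd_matrix n j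
          - real n * (real n * ?d * odd_matrix (n - 1) j)"
      by (simp add: algebra_simps power2_eq_square)
    also have "\<dots> = ?d * (real j * (real j + 1)) * odd_matrix n j
        - (real j + 1) * ((real j + 1) * ?d * odd_matrix n (Suc j))"
      unfolding odd_matrix_pred_left[OF 3] odd_matrix_Suc_right[OF 3]
      by algebra
    also have "\<dots> = ?d * (real j * (real j + 1) * odd_matrix n j
        - (real j + 1)\<^sup>2 * odd_matrix n (Suc j))"
      by algebra
    finally show ?thesis using d by simp
  qed
qed (simp_all add: odd_matrix_diag, simp add: odd_matrix_def)

text \<open>Consecutive entries of a row have the ratio of consecutive weights, up to the factor (n
  - j) / (n - j - 3/2), which tends to 1.\<close>

lemma odd_matrix_limit: "(\<lambda>n. odd_matrix n j / odd_matrix n 0) \<longlonglongrightarrow> wgt j"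
proof (induction j)
  case 0
  show ?case by (simp add: odd_matrix_nonzero wgt_def)
next
  case (Suc j)
  have "(\<lambda>n. (real j + 3/2) / (real j + 1) * ((real n - real j) / (real n - real j - 3/2))
          * (odd_matrix n j / odd_matrix n 0)) \<longlonglongrightarrow> (real j + 3/2) / (real j + 1) * 1 * wgt j"
  proof (intro tendsto_mult tendsto_const Suc)
    have "filterlim (\<lambda>n. - (real j + 3/2) + real n) at_top sequentially"
      by (rule filterlim_tendsto_add_at_top[OF tendsto_const filterlim_real_sequentially])
    then have "filterlim (\<lambda>n. real n - (real j + 3/2)) at_top sequentially"
      by (simp add: algebra_simps)
    then have "(\<lambda>n. (3/2) * inverse (real n - (real j + 3/2))) \<longlonglongrightarrow> (3/2) * 0"
      by (intro tendsto_mult tendsto_const tendsto_inverse_0_at_top)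
    from tendsto_add[OF tendsto_const[of 1] this]
    have *: "(\<lambda>n. 1 + (3/2) * inverse (real n - (real j + 3/2))) \<longlonglongrightarrow> 1"
      by (simp only: mult_zero_right add_0_right)
    have "\<forall>\<^sub>F n in sequentially. 1 + (3/2) * inverse (real n - (real j + 3/2))
        = (real n - real j) / (real n - real j - 3/2)"
      using eventually_gt_at_top[of "j + 2"]
    proof eventually_elim
      case (elim n)
      then have "real n - real j - 3/2 \<noteq> 0" by linarith
      then show ?case by (simp add: divide_simps)
    qed
    with * show "(\<lambda>n. (real n - real j) / (real n - real j - 3/2)) \<longlonglongrightarrow> 1"
      by (rule Lim_transform_eventually)
  qed
  also have "(real j + 3/2) / (real j + 1) * 1 * wgt j = wgt (Suc j)"
    by (simp add: wgt_def)
  finally have lim: "(\<lambda>n. (real j + 3/2) / (real j + 1)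
      * ((real n - real j) / (real n - real j - 3/2))
      * (odd_matrix n j / odd_matrix n 0)) \<longlonglongrightarrow> wgt (Suc j)" .
  have ev: "\<forall>\<^sub>F n in sequentially. (real j + 3/2) / (real j + 1)
      * ((real n - real j) / (real n - real j - 3/2))
      * (odd_matrix n j / odd_matrix n 0) = odd_matrix n (Suc j) / odd_matrix n 0"
    using eventually_gt_at_top[of "j + 2"]
  proof eventually_elim
    case (elim n)
    have pos: "real j + 1 > 0" "real n - real j - 3/2 > 0" using elim by auto
    have "odd_matrix n (Suc j) = (real j + 3/2) * (real n - real j) * odd_matrix n j
        / ((real j + 1) * (real n - real j - 3/2))"
      using odd_matrix_Suc_right[of j n] pos elim by (simp add: nonzero_eq_divide_eq mult_ac)
    then show ?case by simp
  qed
  show ?case by (rule Lim_transform_eventually[OF lim ev])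
qed

section \<open>Matrices for the even and the odd part\<close>

text \<open>Horner's scheme in the Legendre operator: each application of it reaches one more
  subdiagonal, so the matrix is banded.\<close>

lemma legendre_matrix_even_exists:
  fixes a :: "real poly"
  shows "\<exists>A N. legendre_matrix A (a \<circ>\<^sub>p [:0, 1, 1:]) \<and> (\<forall>n j. j + N < n \<longrightarrow> A n j = 0)"
proof (induction a)
  case 0
  show ?case using legendre_matrix_zero by (intro exI[of _ "\<lambda>n j. 0"]) simp
next
  case (pCons c a)
  then obtain A N where A: "legendre_matrix A (a \<circ>\<^sub>p [:0, 1, 1:])"
    and N: "\<And>n j. j + N < n \<Longrightarrow> A n j = 0" by blast
  let ?B = "\<lambda>n j. c * (if n = j then 1 else 0) + legendre_op (A n) j"
  have "legendre_matrix ?B (pCons c a \<circ>\<^sub>p [:0, 1, 1:])"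
    using legendre_matrix_add_smult[OF legendre_matrix_id legendre_matrix_op[OF A], where c = c]
    by (simp add: pcompose_pCons)
  moreover have "?B n j = 0" if "j + Suc N < n" for n j
    using that by (simp add: legendre_op_def N)
  ultimately show ?case by blast
qed

text \<open>Horner's scheme again, now starting from multiples of \<open>odd_matrix\<close>. In the
  limit the rows keep the form weight times polynomial in \<open>j\<close>, and the last clause says
  that this polynomial vanishes only for \<open>b\<close> = 0.\<close>

lemma legendre_matrix_odd_exists:
  fixes b :: "real poly"
  shows "\<exists>A R. legendre_matrix A ((b \<circ>\<^sub>p [:0, 1, 1:]) * [:1, 2:])
     \<and> (\<forall>j. (\<lambda>n. A n j / odd_matrix n 0) \<longlonglongrightarrow> wgt j * poly R (real j))
     \<and> (R = 0 \<longrightarrow> b = 0)"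
proof (induction b)
  case 0
  show ?case using legendre_matrix_zero
    by (intro exI[of _ "\<lambda>n j. 0"] exI[of _ 0]) simp
next
  case (pCons c b)
  then obtain A R where A: "legendre_matrix A ((b \<circ>\<^sub>p [:0, 1, 1:]) * [:1, 2:])"
    and lim: "\<And>j. (\<lambda>n. A n j / odd_matrix n 0) \<longlonglongrightarrow> wgt j * poly R (real j)"
    and R: "R = 0 \<longrightarrow> b = 0" by blast
  let ?B = "\<lambda>n j. c * odd_matrix n j + legendre_op (A n) j"
  \<comment> \<open>\<open>legendre_op\<close> conjugated by the weights: it maps wgt j * R(j) to
    wgt j * L(j), by \<open>wgt_Suc\<close>.\<close>
  define L where "L = [:1, 1:] * ([:0, 1:] * R - [:3/2, 1:] * (R \<circ>\<^sub>p [:1, 1:]))"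
  have L: "poly L x = (x + 1) * (x * poly R x - (x + 3/2) * poly R (x + 1))" for x
    by (simp add: L_def poly_pcompose algebra_simps)
  have "legendre_matrix ?B ((pCons c b \<circ>\<^sub>p [:0, 1, 1:]) * [:1, 2:])"
    using legendre_matrix_add_smult[OF legendre_matrix_odd legendre_matrix_op[OF A], where c = c]
    by (simp add: pcompose_pCons algebra_simps)
  moreover have "(\<lambda>n. ?B n j / odd_matrix n 0) \<longlonglongrightarrow> wgt j * poly ([:c:] + L) (real j)" for j
  proof -
    have "(\<lambda>n. c * (odd_matrix n j / odd_matrix n 0)
        + (real j * (real j + 1) * (A n j / odd_matrix n 0)
          - (real j + 1)\<^sup>2 * (A n (Suc j) / odd_matrix n 0)))
      \<longlonglongrightarrow> c * wgt j + (real j * (real j + 1) * (wgt j * poly R (real j))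
          - (real j + 1)\<^sup>2 * (wgt (Suc j) * poly R (real (Suc j))))"
      by (intro tendsto_intros lim odd_matrix_limit)
    also have "(\<lambda>n. c * (odd_matrix n j / odd_matrix n 0)
        + (real j * (real j + 1) * (A n j / odd_matrix n 0)
          - (real j + 1)\<^sup>2 * (A n (Suc j) / odd_matrix n 0)))
      = (\<lambda>n. ?B n j / odd_matrix n 0)"
      by (simp add: legendre_op_def add_divide_distrib diff_divide_distrib)
    also have "(real j + 1)\<^sup>2 * (wgt (Suc j) * poly R (real (Suc j)))
        = (real j + 1) * ((real j + 1) * wgt (Suc j)) * poly R (real j + 1)"
      by (simp add: power2_eq_square add_ac)
    also have "c * wgt j + (real j * (real j + 1) * (wgt j * poly R (real j))
          - (real j + 1) * ((real j + 1) * wgt (Suc j)) * poly R (real j + 1))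
        = wgt j * poly ([:c:] + L) (real j)"
      unfolding wgt_Suc poly_add L by (simp add: algebra_simps)
    finally show ?thesis .
  qed
  moreover have "pCons c b = 0" if "[:c:] + L = 0"
  proof -
    have 0: "c + poly L x = 0" for x
      using arg_cong[OF that, of "\<lambda>q. poly q x"] by simp
    \<comment> \<open>The factor x + 1 of \<open>L\<close> vanishes at -1, which isolates
      \<open>c\<close>.\<close>
    then have c: "c = 0" using L[of "-1"] 0[of "-1"] by simp
    have rec: "real j * poly R (real j) = (real j + 3/2) * poly R (real (Suc j))" for j
      using 0[of "real j"] L[of "real j"] c by (simp add: add_ac)
    \<comment> \<open>The factor j in \<open>rec\<close> is 0 at j = 0, which starts the chain R(1)
      = R(2) = ... = 0.\<close>
    have "poly R (real (Suc j)) = 0" for j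
    proof (induction j)
      case 0
      then show ?case using rec[of 0] by simp
    next
      case (Suc j)
      then show ?case using rec[of "Suc j"] by (simp add: add_eq_0_iff)
    qed
    then have "range (\<lambda>j. real (Suc j)) \<subseteq> {x. poly R x = 0}" by blast
    moreover have "infinite (range (\<lambda>j. real (Suc j)))"
      by (intro range_inj_infinite injI) simp
    ultimately have "R = 0" using poly_roots_finite finite_subset by blast
    then show ?thesis using R c by simp
  qed
  ultimately show ?case by blast
qed

section \<open>The multiplier operator in powers of u\<close>

text \<open>\<open>rescale\<close> rewrites a polynomial in x as one in u = (1 - x) / 2, and
  \<open>unscale\<close> goes back.\<close>

definition rescale :: "real poly \<Rightarrow> real poly" where
  "rescale y = y \<circ>\<^sub>p [:1, -2:]"

definition unscale :: "real poly \<Rightarrow> real poly" where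
  "unscale y = y \<circ>\<^sub>p [:1/2, -1/2:]"

lemma rescale_unscale: "rescale (unscale y) = y"
  unfolding rescale_def unscale_def by (subst pcompose_assoc[symmetric]) (simp add: pcompose_pCons)

lemma unscale_rescale: "unscale (rescale y) = y"
  unfolding rescale_def unscale_def by (subst pcompose_assoc[symmetric]) (simp add: pcompose_pCons)

lemma rescale_simps:
  "rescale (x + y) = rescale x + rescale y" "rescale (smult c x) = smult c (rescale x)"
  by (simp_all add: rescale_def pcompose_add pcompose_smult)

lemma unscale_simps:
  "unscale (x + y) = unscale x + unscale y" "unscale (smult c x) = smult c (unscale x)"
  "unscale (x - y) = unscale x - unscale y"
  by (simp_all add: unscale_def pcompose_add pcompose_smult pcompose_diff)

definition legendre_diff :: "real poly \<Rightarrow> real poly" where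
  "legendre_diff y = [:-1, 0, 1:] * pderiv (pderiv y) + [:0, 2:] * pderiv y"

lemma legendre_diff_simps:
  "legendre_diff (x + y) = legendre_diff x + legendre_diff y"
  "legendre_diff (smult c x) = smult c (legendre_diff x)"
  by (simp_all add: legendre_diff_def pderiv_add pderiv_smult algebra_simps smult_add_right)

lemma legendre_diff_legendre:
  "legendre_diff (legendre k) = smult (real k * (real k + 1)) (legendre k)"
  using is_legendre_legendre[of k] unfolding is_legendre_def legendre_diff_def by simp

text \<open>In the variable u the operator is (u^2 - u) D^2 + (2 u - 1) D.\<close>

lemma coeff_rescale_legendre_diff:
  "coeff (rescale (legendre_diff y)) j = legendre_op (coeff (rescale y)) j"
proof -
  define e where "e = rescale y"
  have d1: "pderiv e = smult (-2) (pderiv y \<circ>\<^sub>p [:1, -2:])"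
    by (simp add: e_def rescale_def pderiv_pcompose pderiv_pCons)
  have d2: "pderiv (pderiv e) = smult 4 (pderiv (pderiv y) \<circ>\<^sub>p [:1, -2:])"
    by (simp add: d1 pderiv_minus pderiv_smult pderiv_pcompose pderiv_pCons)
  have "[:-1, 0, 1:] \<circ>\<^sub>p [:1, -2:] = smult 4 [:0, -1, 1 :: real:]"
    "[:0, 2:] \<circ>\<^sub>p [:1, -2:] = smult (-2) [:-1, 2 :: real:]"
    by (simp_all add: pcompose_pCons)
  then have "rescale (legendre_diff y) = [:0, -1, 1:] * pderiv (pderiv e) + [:-1, 2:] * pderiv e"
    unfolding d2 unfolding d1 unfolding rescale_def legendre_diff_def
    by (simp only: pcompose_add pcompose_mult mult_smult_left mult_smult_right)
  moreover have "coeff \<dots> j = legendre_op (coeff e) j"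
  proof (cases j)
    case 0
    then show ?thesis by (simp add: coeff_pderiv legendre_op_def)
  next
    case (Suc i)
    then show ?thesis
      by (cases i) (auto simp: coeff_pderiv legendre_op_def power2_eq_square algebra_simps)
  qed
  ultimately show ?thesis by (simp add: e_def)
qed

lemma legendre_diff_unscale_monom:
  "legendre_diff (unscale (monom 1 n)) = unscale (smult (real n * (real n + 1)) (monom 1 n)
     - smult ((real n)\<^sup>2) (monom 1 (n - 1)))" (is "?l = unscale ?r")
proof -
  have "coeff (rescale ?l) j = coeff ?r j" for j
    unfolding coeff_rescale_legendre_diff rescale_unscale
    by (cases n) (auto simp: legendre_op_def power2_eq_square algebra_simps)
  then have "rescale ?l = ?r" by (intro poly_eqI)
  then show ?thesis using unscale_rescale[of ?l] by simp
qed

text \<open>Both \<open>T\<close> and the Legendre operator are diagonal on the Legendre basis,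
  hence commute; triangularity and the diagonal are then derived from this and the
  eigenvalues.\<close>

lemma legendre_matrix_multiplier:
  fixes T :: "real poly \<Rightarrow> real poly"
  assumes T: "Vector_Spaces.linear smult smult T"
    and eig: "\<And>k. T (legendre k) = smult (poly p (real k)) (legendre k)"
  shows "legendre_matrix (\<lambda>n. coeff (rescale (T (unscale (monom 1 n))))) p"
proof -
  define A where "A n = coeff (rescale (T (unscale (monom 1 n))))" for n
  have T_add: "T (x + y) = T x + T y" and T_smult: "T (smult c x) = smult c (T x)" for x y c
    using T unfolding Vector_Spaces.linear_iff by blast+
  have T_diff: "T (x - y) = T x - T y" for x y
    using T_add[of "x - y" y] by (simp add: algebra_simps)
  have commute: "legendre_diff (T y) = T (legendre_diff y)" for y
  proof -
    have lin: "Vector_Spaces.linear smult smult (\<lambda>y. legendre_diff (T y))"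
      "Vector_Spaces.linear smult smult (\<lambda>y. T (legendre_diff y))"
      using T unfolding Vector_Spaces.linear_iff by (simp_all add: legendre_diff_simps)
    have y: "y \<in> rpoly.span (range legendre)" by (simp add: span_legendre)
    have "legendre_diff (T b) = T (legendre_diff b)" if "b \<in> range legendre" for b
      using that by (auto simp: eig legendre_diff_legendre legendre_diff_simps T_smult mult.commute)
    then show ?thesis by (rule rpoly_pair.linear_eq_on[OF lin y])
  qed
  have rec: "real n * (real n + 1) * A n j - (real n)\<^sup>2 * A (n - 1) j = legendre_op (A n) j" for n j
    unfolding A_def coeff_rescale_legendre_diff[symmetric] commute legendre_diff_unscale_monom
    by (simp add: unscale_simps T_diff T_smult) (simp add: rescale_def pcompose_diff pcompose_smult)
  have upper: "A n j = 0" if "n < j" for n j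
    using that
  proof (induction n arbitrary: j rule: less_induct)
    case (less n)
    have pred: "(real n)\<^sup>2 * A (n - 1) j = 0" if "n < j" for j
      using less.IH[of "n - 1" j] that by (cases "n = 0") auto
    have vanish: "A n j = 0" if "n < j" "A n (Suc j) = 0" for j
    proof -
      have "(real n * (real n + 1) - real j * (real j + 1)) * A n j = 0"
        using rec[of n j] pred[OF that(1)] that(2) by (simp add: legendre_op_def algebra_simps)
      then show ?thesis using eigenvalue_less[OF that(1)] by simp
    qed
    \<comment> \<open>Beyond the degree all entries vanish. From there \<open>vanish\<close>
      descends: as long as the column exceeds \<open>n\<close>, a zero in the next column forces a
      zero.\<close>
    define M where "M = max j (Suc (degree (rescale (T (unscale (monom 1 n))))))"
    have M: "A n M = 0" unfolding A_def by (rule coeff_eq_0) (simp add: M_def)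
    have "n < k \<longrightarrow> A n k = 0" if "k \<le> M" for k
      using that
    proof (induction k rule: inc_induct)
      case (step k)
      then show ?case using vanish[of k] by simp
    qed (simp add: M)
    then show ?case using less.prems by (simp add: M_def)
  qed
  have "A n n = poly p (real n)" for n
  proof -
    \<comment> \<open>The coefficients of u^n in T(P_n) = p(n) P_n are compared; by
      \<open>upper\<close> only the image of u^n contributes on the left.\<close>
    define e where "e = rescale (legendre n)"
    have deg: "degree e = n" by (simp add: e_def rescale_def degree_pcompose degree_legendre)
    have "e \<noteq> 0"
      using legendre_nonzero[of n] unscale_rescale[of "legendre n"]
      by (auto simp: e_def unscale_def)
    then have ne: "coeff e n \<noteq> 0" using deg leading_coeff_0_iff by blast
    have sum_hom: "coeff (rescale (T (unscale (\<Sum>i\<in>I. smult (c i) (monom 1 i))))) n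
        = (\<Sum>i\<in>I. c i * A i n)" if "finite I" for I c
      using that
    proof (induction I)
      case empty
      have "T 0 = 0" using T_diff[of 0 0] by simp
      then show ?case by (simp add: rescale_def unscale_def)
    next
      case (insert i I)
      then show ?case by (simp add: unscale_simps T_add T_smult rescale_simps A_def)
    qed
    have e: "e = (\<Sum>i\<le>n. smult (coeff e i) (monom 1 i))"
      using poly_as_sum_of_monoms[of e] by (simp add: deg smult_monom)
    have "poly p (real n) * coeff e n = coeff (rescale (T (unscale e))) n"
      by (simp add: e_def unscale_rescale eig rescale_simps)
    also have "\<dots> = (\<Sum>i\<le>n. coeff e i * A i n)"
      by (subst e) (rule sum_hom, simp)
    also have "\<dots> = coeff e n * A n n"
      by (subst sum.remove[of _ n]) (auto intro!: sum.neutral simp: upper)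
    finally show ?thesis using ne by simp
  qed
  with upper rec show ?thesis
    unfolding legendre_matrix_def A_def[symmetric] by (simp add: legendre_op_def)
qed

section \<open>The limit of Newton's inequalities for the images of u^n\<close>

lemma hyperbolic_monom: "hyperbolic (monom 1 n)"
  using hyperbolic_power[OF hyperbolic_linear[of 0 1], of n] by (simp add: monom_altdef)

theorem theorem2:
  fixes \<gamma> :: "nat \<Rightarrow> real" and p :: "real poly"
  assumes "legendre_multiplier_sequence \<gamma>"
    and "\<And>k. \<gamma> k = poly p (real k)"
  shows "\<exists>h :: real poly. p = h \<circ>\<^sub>p [:0, 1, 1:]"
proof -
  obtain T where T: "Vector_Spaces.linear smult smult T"
    and eig: "\<And>k. T (legendre k) = smult (poly p (real k)) (legendre k)"
    and hyp: "hyperbolicity_preserver T"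
    using assms unfolding legendre_multiplier_sequence_def by auto
  define A where "A n = coeff (rescale (T (unscale (monom 1 n))))" for n
  have A: "legendre_matrix A p"
    unfolding A_def using legendre_matrix_multiplier[OF T eig] .
  have newton: "real (j + 2) * (A n j * A n (j + 2)) \<le> real (j + 1) * (A n (j + 1))\<^sup>2" for n j
  proof -
    have "hyperbolic (unscale (monom 1 n))"
      unfolding unscale_def by (intro hyperbolic_pcompose_linear hyperbolic_monom) simp
    then have "hyperbolic (T (unscale (monom 1 n)))"
      using hyp by (simp add: hyperbolicity_preserver_def)
    then have "hyperbolic (rescale (T (unscale (monom 1 n))))"
      unfolding rescale_def by (intro hyperbolic_pcompose_linear) simp_all
    then show ?thesis unfolding A_def by (rule hyperbolic_newton)
  qed
  obtain a b where p: "p = a \<circ>\<^sub>p [:0, 1, 1:] + (b \<circ>\<^sub>p [:0, 1, 1:]) * [:1, 2:]"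
    using poly_even_odd_decomposition by blast
  obtain E N where E: "legendre_matrix E (a \<circ>\<^sub>p [:0, 1, 1:])"
    and N: "\<And>n j. j + N < n \<Longrightarrow> E n j = 0"
    using legendre_matrix_even_exists by blast
  obtain B R where B: "legendre_matrix B ((b \<circ>\<^sub>p [:0, 1, 1:]) * [:1, 2:])"
    and lim: "\<And>j. (\<lambda>n. B n j / odd_matrix n 0) \<longlonglongrightarrow> wgt j * poly R (real j)"
    and R: "R = 0 \<longrightarrow> b = 0"
    using legendre_matrix_odd_exists by blast
  \<comment> \<open>The sum of the two matrices has diagonal \<open>p\<close>, so uniqueness
    identifies it with the matrix of \<open>T\<close>.\<close>
  have AEB: "A n j = E n j + B n j" for n j
    using legendre_matrix_unique[OF A, of "\<lambda>n j. 1 * E n j + B n j"]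
      legendre_matrix_add_smult[OF E B, of 1] by (simp add: p)
  define g where "g j = wgt j * poly R (real j)" for j
  have lim_A: "(\<lambda>n. A n j / odd_matrix n 0) \<longlonglongrightarrow> g j" for j
  proof (rule Lim_transform_eventually)
    show "(\<lambda>n. B n j / odd_matrix n 0) \<longlonglongrightarrow> g j" unfolding g_def by (rule lim)
    \<comment> \<open>In column \<open>j\<close> the banded matrix \<open>E\<close> is zero once n
      exceeds j + N.\<close>
    show "\<forall>\<^sub>F n in sequentially. B n j / odd_matrix n 0 = A n j / odd_matrix n 0"
      using eventually_gt_at_top[of "j + N"] by eventually_elim (simp add: AEB N)
  qed
  have newton_g: "real (j + 2) * (g j * g (j + 2)) \<le> real (j + 1) * (g (j + 1))\<^sup>2" for j
  proof (rule LIMSEQ_le)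
    let ?A = "\<lambda>n j. A n j / odd_matrix n 0"
    show "(\<lambda>n. real (j + 2) * (?A n j * ?A n (j + 2))) \<longlonglongrightarrow> real (j + 2) * (g j * g (j + 2))"
      "(\<lambda>n. real (j + 1) * (?A n (j + 1))\<^sup>2) \<longlonglongrightarrow> real (j + 1) * (g (j + 1))\<^sup>2"
      by (intro tendsto_intros lim_A)+
    \<comment> \<open>Both sides are quadratic in the row, so the normalizer enters as a square,
      whatever its sign.\<close>
    have "real (j + 2) * (?A n j * ?A n (j + 2)) \<le> real (j + 1) * (?A n (j + 1))\<^sup>2" for n
      using divide_right_mono[OF newton[of j n], of "(odd_matrix n 0)\<^sup>2"]
      by (simp add: power2_eq_square)
    then show "\<exists>N. \<forall>n\<ge>N. real (j + 2) * (?A n j * ?A n (j + 2)) \<le> real (j + 1) * (?A n (j + 1))\<^sup>2"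
      by blast
  qed
  have "R = 0"
  proof (rule ccontr)
    assume "R \<noteq> 0"
    \<comment> \<open>The first factor is (j + 3/2) / (j + 1), the ratio of consecutive
      weights.\<close>
    have "(\<lambda>j. (1 + 1/2 * inverse (real (Suc j))) * (poly R (real (Suc j)) / poly R (real j)))
        \<longlonglongrightarrow> (1 + 1/2 * 0) * 1"
      by (intro tendsto_intros LIMSEQ_inverse_real_of_nat poly_shift_ratio_tendsto_1 \<open>R \<noteq> 0\<close>)
    moreover have "(1 + 1/2 * inverse (real (Suc j))) * (poly R (real (Suc j)) / poly R (real j))
        = g (Suc j) / g j" for j
    proof -
      have "wgt (Suc j) = wgt j * (1 + 1/2 * inverse (real (Suc j)))"
        by (simp add: wgt_def field_simps)
      then show ?thesis using wgt_pos[of j] by (simp add: g_def)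
    qed
    ultimately have "(\<lambda>j. g (Suc j) / g j) \<longlonglongrightarrow> 1" by simp
    then show False using newton_g by (rule newton_inequalities_ratio_not_1)
  qed
  then show ?thesis using R p by auto
qed

end
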